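(* In the graceful game, Bob has a winning strategy on the square of the path $P_n^2$ for every $n\geq 4$, and Alice has a winning strategy on $P_3^2$ (no matter who starts).
   Context: $P_n$ is the path $(v_0,\dots,v_{n-1})$ on $n$ vertices; $P_n^2$ is the graph on the same vertex set in which two distinct vertices are adjacent iff their distance in $P_n$ is at most $2$ (so $|E(P_n^2)|=2n-3$ for $n\geq 2$). A graceful labeling of a graph $G$ with $m$ edges is an injective map $f\colon V(G)\to\{0,1,\dots,m\}$ such that the induced edge labels $|f(u)-f(v)|$, $uv\in E(G)$, are pairwise distinct. The graceful game on a simple graph $G$ with $m$ edges: two players, Alice and Bob, alternately choose a free (not yet labeled) vertex and assign to it a label from $\{0,1,\dots,m\}$ not yet used. An edge both of whose endpoints are labeled gets label $|f(u)-f(v)|$; a move is legal only if after it all edge labels are pairwise distinct. Alice wins if the whole graph ends up gracefully labeled; Bob wins if he can prevent this. Either player may be the first to move. *)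

theory Defs
  imports Main "HOL-Library.Extended_Nat"
begin

record 'v graph =
  verts :: "'v set"
  edges :: "'v set set"

definition walk :: "'v graph \<Rightarrow> 'v list \<Rightarrow> bool" where
  "walk G p \<longleftrightarrow> p \<noteq> [] \<and> set p \<subseteq> verts G \<and>
     (\<forall>i. Suc i < length p \<longrightarrow> {p ! i, p ! Suc i} \<in> edges G)"

text \<open>The infimum is \<open>\<infinity>\<close> if no walk joins the two vertices.\<close>

definition graph_dist :: "'v graph \<Rightarrow> 'v \<Rightarrow> 'v \<Rightarrow> enat" where
  "graph_dist G u v =
     (INF p \<in> {p. walk G p \<and> hd p = u \<and> last p = v}. enat (length p - 1))"

definition path_graph :: "nat \<Rightarrow> nat graph" where
  "path_graph n = \<lparr>verts = {..<n}, edges = {{i, Suc i} | i. Suc i < n}\<rparr>"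

definition graph_square :: "'v graph \<Rightarrow> 'v graph" where
  "graph_square G = \<lparr>verts = verts G,
     edges = {{u, v} | u v. u \<in> verts G \<and> v \<in> verts G \<and> u \<noteq> v \<and> graph_dist G u v \<le> 2}\<rparr>"

definition edge_label :: "('v \<Rightarrow> nat) \<Rightarrow> 'v \<Rightarrow> 'v \<Rightarrow> int" where
  "edge_label f u v = \<bar>int (f u) - int (f v)\<bar>"

text \<open>The set \<open>A\<close> consists of the vertices that already carry a label; only edges with
  both endpoints in \<open>A\<close> have an edge label.\<close>

definition distinct_edge_labels :: "'v graph \<Rightarrow> 'v set \<Rightarrow> ('v \<Rightarrow> nat) \<Rightarrow> bool" where
  "distinct_edge_labels G A f \<longleftrightarrow>
     (\<forall>u\<in>A. \<forall>v\<in>A. \<forall>x\<in>A. \<forall>y\<in>A.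
        {u, v} \<in> edges G \<longrightarrow> {x, y} \<in> edges G \<longrightarrow> {u, v} \<noteq> {x, y} \<longrightarrow>
        edge_label f u v \<noteq> edge_label f x y)"

definition graceful_labeling :: "'v graph \<Rightarrow> ('v \<Rightarrow> nat) \<Rightarrow> bool" where
  "graceful_labeling G f \<longleftrightarrow>
     f ` verts G \<subseteq> {0..card (edges G)} \<and> inj_on f (verts G) \<and>
     distinct_edge_labels G (verts G) f"

datatype player = Alice | Bob

fun opponent :: "player \<Rightarrow> player" where
  "opponent Alice = Bob"
| "opponent Bob = Alice"

text \<open>A play is the chronological list of the moves made so far, a move being a vertex
  together with the label assigned to it. No vertex is labeled twice in a legal play, so
  \<open>map_of\<close> turns such a play into the partial labeling it has produced.\<close>

type_synonym 'v move = "'v \<times> nat"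
type_synonym 'v play = "'v move list"
type_synonym 'v strategy = "'v play \<Rightarrow> 'v move"

definition legal_move :: "'v graph \<Rightarrow> 'v play \<Rightarrow> 'v move \<Rightarrow> bool" where
  "legal_move G h m \<longleftrightarrow> (case m of (v, l) \<Rightarrow>
     v \<in> verts G \<and> v \<notin> dom (map_of h) \<and>
     l \<in> {0..card (edges G)} \<and> l \<notin> ran (map_of h) \<and>
     (let f = (map_of h)(v \<mapsto> l) in distinct_edge_labels G (dom f) (the \<circ> f)))"

definition legal_play :: "'v graph \<Rightarrow> 'v play \<Rightarrow> bool" where
  "legal_play G h \<longleftrightarrow> (\<forall>k < length h. legal_move G (take k h) (h ! k))"

text \<open>The legal moves do not depend on whose turn it is, so the game is over as soon as
  the player to move has none.\<close>

definition finished :: "'v graph \<Rightarrow> 'v play \<Rightarrow> bool" where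
  "finished G h \<longleftrightarrow> \<not> (\<exists>m. legal_move G h m)"

definition winner :: "'v graph \<Rightarrow> 'v play \<Rightarrow> player" where
  "winner G h =
     (if dom (map_of h) = verts G \<and> graceful_labeling G (the \<circ> map_of h) then Alice else Bob)"

definition to_move :: "player \<Rightarrow> 'v play \<Rightarrow> player" where
  "to_move first h = (if even (length h) then first else opponent first)"

definition follows :: "player \<Rightarrow> player \<Rightarrow> 'v strategy \<Rightarrow> 'v play \<Rightarrow> bool" where
  "follows first p \<sigma> h \<longleftrightarrow>
     (\<forall>k < length h. to_move first (take k h) = p \<longrightarrow> h ! k = \<sigma> (take k h))"

text \<open>The second clause keeps \<open>\<sigma>\<close> from winning vacuously by prescribing illegal moves.
  Legal plays are bounded by the number of vertices, so on a finite graph every play that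
  follows \<open>\<sigma>\<close> extends to a finished one.\<close>

definition winning_strategy :: "'v graph \<Rightarrow> player \<Rightarrow> player \<Rightarrow> 'v strategy \<Rightarrow> bool" where
  "winning_strategy G first p \<sigma> \<longleftrightarrow>
     (\<forall>h. legal_play G h \<longrightarrow> follows first p \<sigma> h \<longrightarrow>
        (finished G h \<longrightarrow> winner G h = p) \<and>
        (\<not> finished G h \<longrightarrow> to_move first h = p \<longrightarrow> legal_move G h (\<sigma> h)))"

definition has_winning_strategy :: "'v graph \<Rightarrow> player \<Rightarrow> player \<Rightarrow> bool" where
  "has_winning_strategy G first p \<longleftrightarrow> (\<exists>\<sigma>. winning_strategy G first p \<sigma>)"

end

theory Submission
  imports Defs
begin

text \<open>
  A partial labeling is doomed if no graceful labeling extends it; Bob wins as soon as the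
  position is doomed. There are two obstructions. Write \<open>m = 2 * n - 3\<close>. All labels
  \<open>1, \<dots>, m\<close> occur on the edges of a graceful labeling, so the labels \<open>0\<close> and \<open>m\<close> sit on
  adjacent vertices. Moreover the sum of all edge labels is known, and modulo 2 it only depends on
  the labels of the two vertices \<open>1\<close> and \<open>n - 2\<close> of odd degree, whose sum is therefore congruent
  to \<open>n - 1\<close>. Putting an extreme label on one of these two vertices threatens both to put
  the other extreme label on a vertex that is not adjacent and to put a label of the wrong parity
  on the other vertex of odd degree, and Alice cannot parry both threats. Near the ends of
  the path the labels available to Bob may be exhausted; for \<open>n \<le> 7\<close> the positions concerned
  are settled by exhaustive search.
\<close>

section \<open>Adjacency and edges of the square of a path\<close>

definition adj :: "nat \<Rightarrow> nat \<Rightarrow> nat \<Rightarrow> bool" where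
  "adj n u v \<longleftrightarrow> u < n \<and> v < n \<and> u \<noteq> v \<and> u \<le> v + 2 \<and> v \<le> u + 2"

abbreviation path_square :: "nat \<Rightarrow> nat graph" where
  "path_square n \<equiv> graph_square (path_graph n)"

lemma adj_sym: "adj n u v \<longleftrightarrow> adj n v u"
  by (auto simp: adj_def)

lemma adj_irrefl [simp]: "\<not> adj n u u"
  by (simp add: adj_def)

lemma path_graph_edge_iff: "{a, b} \<in> edges (path_graph n) \<longleftrightarrow> a < n \<and> b < n \<and> (b = Suc a \<or> a = Suc b)"
  by (auto simp: path_graph_def doubleton_eq_iff)

lemma path_walk_bound:
  assumes "walk (path_graph n) p"
  shows "hd p \<le> last p + (length p - 1) \<and> last p \<le> hd p + (length p - 1)"
proof -
  have "p ! k \<le> p ! 0 + k \<and> p ! 0 \<le> p ! k + k" if "k < length p" for k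
    using that
  proof (induction k)
    case (Suc k)
    have "{p ! k, p ! Suc k} \<in> edges (path_graph n)"
      using assms Suc.prems by (auto simp: walk_def)
    then show ?case using Suc by (auto simp: path_graph_edge_iff)
  qed simp
  from this[of "length p - 1"] show ?thesis
    using assms by (auto simp: walk_def hd_conv_nth last_conv_nth)
qed

lemma path_graph_dist_le_iff:
  assumes "u < n" "v < n"
  shows "graph_dist (path_graph n) u v \<le> 2 \<longleftrightarrow> u \<le> v + 2 \<and> v \<le> u + 2"
proof
  let ?W = "{p. walk (path_graph n) p \<and> hd p = u \<and> last p = v}"
  let ?I = "(\<lambda>p. enat (length p - 1)) ` ?W"
  assume le: "graph_dist (path_graph n) u v \<le> 2"
  \<comment> \<open>Without walks the infimum would be infinite, against \<open>le\<close>. For a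
    nonempty set the infimum in the well-order \<open>enat\<close> is attained, so some walk
    realizes the distance.\<close>
  have "?W \<noteq> {}"
  proof
    assume "?W = {}"
    then have "graph_dist (path_graph n) u v = Inf {}" by (simp only: graph_dist_def image_empty)
    then show False using le by (simp add: top_enat_def)
  qed
  then have "Inf ?I \<in> ?I" by (intro wellorder_InfI[of "enat (length (SOME p. p \<in> ?W) - 1)"]) (metis (no_types, lifting) imageI someI_ex ex_in_conv)
  then obtain p where p: "p \<in> ?W" "Inf ?I = enat (length p - 1)" by auto
  have "enat (length p - 1) \<le> enat 2"
    using le p(2) by (simp add: graph_dist_def numeral_eq_enat)
  then show "u \<le> v + 2 \<and> v \<le> u + 2"
    using path_walk_bound[of n p] p(1) by auto
next
  assume near: "u \<le> v + 2 \<and> v \<le> u + 2"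
  have "\<exists>p. walk (path_graph n) p \<and> hd p = u \<and> last p = v \<and> length p \<le> 3"
  proof -
    have walk: "walk (path_graph n) [u, v]" if "v = Suc u \<or> u = Suc v"
      using that assms path_graph_edge_iff[of u v n]
      by (auto simp: walk_def less_Suc_eq path_graph_def)
    have walk2: "walk (path_graph n) [u, w, v]"
      if "w = Suc u \<or> u = Suc w" "v = Suc w \<or> w = Suc v" "w < n" for w
      using that assms path_graph_edge_iff[of u w n] path_graph_edge_iff[of w v n]
      by (auto simp: walk_def less_Suc_eq path_graph_def nth_Cons')
    consider "u = v" | "v = Suc u \<or> u = Suc v" | "v = Suc (Suc u)" | "u = Suc (Suc v)"
      using near by linarith
    then show ?thesis
    proof cases
      case 1
      have "walk (path_graph n) [u]" using assms by (auto simp: walk_def path_graph_def)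
      with 1 show ?thesis by (intro exI[of _ "[u]"]) auto
    next
      case 2
      with walk show ?thesis by (intro exI[of _ "[u, v]"]) auto
    next
      case 3
      with walk2[of "Suc u"] assms show ?thesis by (intro exI[of _ "[u, Suc u, v]"]) auto
    next
      case 4
      with walk2[of "Suc v"] assms show ?thesis by (intro exI[of _ "[u, Suc v, v]"]) auto
    qed
  qed
  then obtain p where p: "walk (path_graph n) p" "hd p = u" "last p = v" "length p \<le> 3" by blast
  have "graph_dist (path_graph n) u v \<le> enat (length p - 1)"
    unfolding graph_dist_def by (rule INF_lower) (use p in auto)
  also have "\<dots> \<le> 2" using p(4) by (simp add: numeral_eq_enat)
  finally show "graph_dist (path_graph n) u v \<le> 2" .
qed

lemma verts_path_square [simp]: "verts (path_square n) = {..<n}"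
  by (simp add: graph_square_def path_graph_def)

lemma edge_iff_adj: "{u, v} \<in> edges (path_square n) \<longleftrightarrow> adj n u v"
proof -
  have "{u, v} \<in> edges (path_square n) \<longleftrightarrow>
      u < n \<and> v < n \<and> u \<noteq> v \<and> graph_dist (path_graph n) u v \<le> 2"
    using path_graph_dist_le_iff[of u n v] path_graph_dist_le_iff[of v n u]
    by (auto simp: graph_square_def path_graph_def doubleton_eq_iff)
  then show ?thesis
    using path_graph_dist_le_iff[of u n v] by (auto simp: adj_def)
qed

text \<open>Every edge occurs once, smaller endpoint first. Splitting by the two possible gaps turns
  sums over edges into sums over initial segments, which suits induction on
  \<open>n\<close>.\<close>

definition edge_pairs :: "nat \<Rightarrow> (nat \<times> nat) set" where
  "edge_pairs n = (\<lambda>i. (i, Suc i)) ` {..<n - 1} \<union> (\<lambda>i. (i, Suc (Suc i))) ` {..<n - 2}"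

lemma edge_pairs_iff: "(u, v) \<in> edge_pairs n \<longleftrightarrow> adj n u v \<and> u < v"
  by (auto simp: edge_pairs_def adj_def image_iff)

lemma sum_edge_pairs:
  "sum h (edge_pairs n) = (\<Sum>i<n - 1. h (i, Suc i)) + (\<Sum>i<n - 2. h (i, Suc (Suc i)))"
  unfolding edge_pairs_def
  by (subst sum.union_disjoint) (auto simp: sum.reindex inj_on_def)

lemma finite_edge_pairs [simp]: "finite (edge_pairs n)"
  by (simp add: edge_pairs_def)

lemma card_edge_pairs: "n \<ge> 2 \<Longrightarrow> card (edge_pairs n) = 2 * n - 3"
  using sum_edge_pairs[of "\<lambda>_. 1::nat" n] by simp

lemma card_edges_path_square:
  assumes "n \<ge> 2"
  shows "card (edges (path_square n)) = 2 * n - 3"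
proof -
  have "edges (path_square n) = (\<lambda>(u, v). {u, v}) ` edge_pairs n"
  proof (intro set_eqI iffI)
    fix e assume e: "e \<in> edges (path_square n)"
    then obtain u v where uv: "e = {u, v}" by (auto simp: graph_square_def)
    with e have "adj n u v" by (simp add: edge_iff_adj)
    then have "(u, v) \<in> edge_pairs n \<or> (v, u) \<in> edge_pairs n"
      by (auto simp: edge_pairs_iff adj_def)
    then show "e \<in> (\<lambda>(u, v). {u, v}) ` edge_pairs n" using uv by force
  next
    fix e assume "e \<in> (\<lambda>(u, v). {u, v}) ` edge_pairs n"
    then show "e \<in> edges (path_square n)"
      by (auto simp: edge_pairs_iff edge_iff_adj)
  qed
  moreover have "inj_on (\<lambda>(u, v). {u, v}) (edge_pairs n)"
    by (auto simp: inj_on_def edge_pairs_iff doubleton_eq_iff)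
  ultimately show ?thesis by (simp add: card_image card_edge_pairs[OF assms])
qed

section \<open>Winning strategies\<close>

lemma legal_play_snoc:
  "legal_play G (h @ [m]) \<longleftrightarrow> legal_play G h \<and> legal_move G h m"
  by (auto simp: legal_play_def nth_append less_Suc_eq)

lemma follows_snoc:
  "follows first p \<sigma> (h @ [m]) \<longleftrightarrow>
     follows first p \<sigma> h \<and> (to_move first h = p \<longrightarrow> m = \<sigma> h)"
  by (auto simp: follows_def nth_append less_Suc_eq)

text \<open>\<open>W\<close> is an invariant: the strategy picks some legal move that preserves it,
  and the opponent cannot leave it. By induction on the play it holds along every legal play that
  follows the strategy.\<close>

lemma has_winning_strategyI:
  assumes "W []"
    and over: "\<And>h. legal_play G h \<Longrightarrow> W h \<Longrightarrow> finished G h \<Longrightarrow> winner G h = p"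
    and own: "\<And>h. legal_play G h \<Longrightarrow> W h \<Longrightarrow> \<not> finished G h \<Longrightarrow> to_move first h = p \<Longrightarrow>
        \<exists>m. legal_move G h m \<and> W (h @ [m])"
    and other: "\<And>h m. legal_play G h \<Longrightarrow> W h \<Longrightarrow> legal_move G h m \<Longrightarrow> to_move first h \<noteq> p \<Longrightarrow>
        W (h @ [m])"
  shows "has_winning_strategy G first p"
proof -
  define \<sigma> where "\<sigma> h = (SOME m. legal_move G h m \<and> W (h @ [m]))" for h
  have \<sigma>: "legal_move G h (\<sigma> h) \<and> W (h @ [\<sigma> h])"
    if "legal_play G h" "W h" "\<not> finished G h" "to_move first h = p" for h
    unfolding \<sigma>_def by (rule someI_ex) (rule own[OF that])
  have W: "W h" if "legal_play G h" "follows first p \<sigma> h" for h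
    using that
  proof (induction h rule: rev_induct)
    case Nil
    show ?case by (rule assms(1))
  next
    case (snoc m h)
    then have legal: "legal_play G h" "legal_move G h m" and "follows first p \<sigma> h"
      and move: "to_move first h = p \<Longrightarrow> m = \<sigma> h"
      by (auto simp: legal_play_snoc follows_snoc)
    then have "W h" using snoc.IH by blast
    show ?case
    proof (cases "to_move first h = p")
      case True
      have "\<not> finished G h" using legal(2) unfolding finished_def by blast
      with \<sigma>[OF legal(1) \<open>W h\<close> _ True] move[OF True] show ?thesis by simp
    qed (use other legal \<open>W h\<close> in blast)
  qed
  have "winning_strategy G first p \<sigma>"
    unfolding winning_strategy_def using W over \<sigma> by blast
  then show ?thesis by (auto simp: has_winning_strategy_def)
qed

section \<open>Positions and the positions won for Bob\<close>

type_synonym position = "nat \<Rightarrow> nat option"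

definition okay :: "nat \<Rightarrow> position \<Rightarrow> bool" where
  "okay n f \<longleftrightarrow> (\<forall>u v x y a b c d. f u = Some a \<longrightarrow> f v = Some b \<longrightarrow> f x = Some c \<longrightarrow> f y = Some d \<longrightarrow>
     adj n u v \<longrightarrow> adj n x y \<longrightarrow> {u, v} \<noteq> {x, y} \<longrightarrow> \<bar>int a - int b\<bar> \<noteq> \<bar>int c - int d\<bar>)"

definition legal :: "nat \<Rightarrow> position \<Rightarrow> nat \<Rightarrow> nat \<Rightarrow> bool" where
  "legal n f v l \<longleftrightarrow> v < n \<and> f v = None \<and> l \<le> 2 * n - 3 \<and> l \<notin> ran f \<and> okay n (f(v \<mapsto> l))"

lemma distinct_edge_labels_iff_okay:
  "distinct_edge_labels (path_square n) (dom f) (the \<circ> f) \<longleftrightarrow> okay n f"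
  unfolding distinct_edge_labels_def okay_def edge_iff_adj edge_label_def dom_def by fastforce

lemma legal_move_iff:
  assumes "n \<ge> 2"
  shows "legal_move (path_square n) h (v, l) \<longleftrightarrow> legal n (map_of h) v l"
  unfolding legal_move_def legal_def Let_def prod.case distinct_edge_labels_iff_okay
  by (simp add: card_edges_path_square[OF assms] domIff)

definition doomed :: "nat \<Rightarrow> position \<Rightarrow> bool" where
  "doomed n f \<longleftrightarrow>
     \<not> (\<exists>g. graceful_labeling (path_square n) g \<and> (\<forall>v<n. \<forall>l. f v = Some l \<longrightarrow> g v = l))"

lemma doomed_upd: "doomed n f \<Longrightarrow> f v = None \<Longrightarrow> doomed n (f(v \<mapsto> l))"
  unfolding doomed_def by (metis fun_upd_apply option.distinct(1))

text \<open>The Boolean argument tells whether Bob is to move.\<close>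

inductive bob_wins :: "nat \<Rightarrow> bool \<Rightarrow> position \<Rightarrow> bool" for n where
  doomed: "doomed n f \<Longrightarrow> bob_wins n t f"
| bob: "legal n f v l \<Longrightarrow> bob_wins n False (f(v \<mapsto> l)) \<Longrightarrow> bob_wins n True f"
| alice: "v < n \<Longrightarrow> f v = None \<Longrightarrow> (\<And>v l. legal n f v l \<Longrightarrow> bob_wins n True (f(v \<mapsto> l))) \<Longrightarrow>
    bob_wins n False f"

lemma map_of_snoc: "map_of h v = None \<Longrightarrow> map_of (h @ [(v, l)]) = (map_of h)(v \<mapsto> l)"
  by (auto simp: map_add_def fun_eq_iff split: option.split)

text \<open>The invariant is that the current position is won for Bob. A doomed position stays
  doomed under every further move, so there Bob may play any legal move.\<close>

lemma bob_has_winning_strategy: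
  assumes "n \<ge> 2" "bob_wins n (first = Bob) Map.empty"
  shows "has_winning_strategy (path_square n) first Bob"
proof (rule has_winning_strategyI[where W = "\<lambda>h. bob_wins n (to_move first h = Bob) (map_of h)"])
  let ?G = "path_square n"
  let ?W = "\<lambda>h. bob_wins n (to_move first h = Bob) (map_of h)"
  note legal_iff = legal_move_iff[OF assms(1)]
  have turn: "to_move first (h @ [m]) = Bob \<longleftrightarrow> to_move first h \<noteq> Bob" for h :: "nat play" and m
    by (cases first) (auto simp: to_move_def)
  have snoc: "map_of (h @ [(v, l)]) = (map_of h)(v \<mapsto> l)" if "legal n (map_of h) v l" for h v l
    using that by (simp add: legal_def map_of_snoc del: map_of_append)
  show "?W []" using assms(2) by (simp add: to_move_def)
  {
    fix h assume "?W h" "finished ?G h"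
    \<comment> \<open>With no legal move left, \<open>bob_wins\<close> can only come from a doomed
      position or from rule \<open>alice\<close>. The free vertex demanded by that rule shows that
      the labeling is incomplete, which Bob also wins.\<close>
    then have "(\<forall>v l. \<not> legal n (map_of h) v l)"
      by (auto simp: finished_def legal_iff)
    with \<open>?W h\<close> have "doomed n (map_of h) \<or> (\<exists>v<n. map_of h v = None)"
      by (auto elim: bob_wins.cases)
    then show "winner ?G h = Bob"
    proof
      assume "doomed n (map_of h)"
      then have "\<not> graceful_labeling ?G (the \<circ> map_of h)"
        unfolding doomed_def by (metis comp_apply option.sel)
      then show ?thesis by (simp add: winner_def)
    next
      assume "\<exists>v<n. map_of h v = None"
      then have "dom (map_of h) \<noteq> verts ?G" by (auto simp: domIff)
      then show ?thesis by (simp add: winner_def)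
    qed
  next
    fix h assume W: "?W h" and nf: "\<not> finished ?G h" and Bob: "to_move first h = Bob"
    from nf obtain v l where vl: "legal n (map_of h) v l"
      by (auto simp: finished_def legal_iff)
    from W Bob have "bob_wins n True (map_of h)" by simp
    then have "\<exists>v l. legal n (map_of h) v l \<and> bob_wins n False ((map_of h)(v \<mapsto> l))"
    proof cases
      case doomed
      with vl have "doomed n ((map_of h)(v \<mapsto> l))" by (auto simp: legal_def doomed_upd)
      with vl show ?thesis by (blast intro: bob_wins.doomed)
    qed (blast, simp)
    then obtain v l where "legal n (map_of h) v l" "bob_wins n False ((map_of h)(v \<mapsto> l))"
      by blast
    then show "\<exists>m. legal_move ?G h m \<and> ?W (h @ [m])"
      by (intro exI[of _ "(v, l)"]) (simp add: legal_iff turn Bob snoc del: map_of_append)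
  next
    fix h and m :: "nat move"
    assume W: "?W h" and m: "legal_move ?G h m" and Alice: "to_move first h \<noteq> Bob"
    obtain v l where vl: "m = (v, l)" by (cases m)
    with m have leg: "legal n (map_of h) v l" by (simp add: legal_iff)
    from W Alice have "bob_wins n False (map_of h)" by simp
    then have "bob_wins n True ((map_of h)(v \<mapsto> l))"
    proof cases
      case doomed
      with leg show ?thesis by (auto simp: legal_def doomed_upd intro: bob_wins.doomed)
    qed (simp, use leg in blast)
    then show "?W (h @ [m])"
      using leg Alice by (simp add: vl turn snoc del: map_of_append)
  }
qed

section \<open>Two obstructions to graceful labelings\<close>

lemma graceful_inj:
  "graceful_labeling (path_square n) g \<Longrightarrow> u < n \<Longrightarrow> v < n \<Longrightarrow> g u = g v \<longleftrightarrow> u = v"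
  by (auto simp: graceful_labeling_def inj_on_def)

lemma graceful_le:
  "n \<ge> 2 \<Longrightarrow> graceful_labeling (path_square n) g \<Longrightarrow> v < n \<Longrightarrow> g v \<le> 2 * n - 3"
  by (auto simp: graceful_labeling_def card_edges_path_square)

lemma graceful_distinct:
  assumes "graceful_labeling (path_square n) g"
    and "adj n u v" "adj n x y" "{u, v} \<noteq> {x, y}"
  shows "\<bar>int (g u) - int (g v)\<bar> \<noteq> \<bar>int (g x) - int (g y)\<bar>"
proof -
  have "u \<in> {..<n}" "v \<in> {..<n}" "x \<in> {..<n}" "y \<in> {..<n}"
    using assms(2,3) by (auto simp: adj_def)
  with assms show ?thesis
    unfolding graceful_labeling_def distinct_edge_labels_def edge_iff_adj edge_label_def
      verts_path_square by auto
qed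

text \<open>There are \<open>2 * n - 3\<close> edges with distinct labels in an interval of that
  many integers, so every integer of the interval occurs.\<close>

lemma graceful_edge_labels:
  assumes "n \<ge> 2" "graceful_labeling (path_square n) g"
  defines "lab \<equiv> \<lambda>(u, v). \<bar>int (g u) - int (g v)\<bar>"
  shows "inj_on lab (edge_pairs n)" "lab ` edge_pairs n = {1..int (2 * n - 3)}"
proof -
  have distinct: "lab (u, v) \<noteq> lab (x, y)"
    if "adj n u v" "adj n x y" "{u, v} \<noteq> {x, y}" for u v x y
    using graceful_distinct[OF assms(2) that] by (simp add: lab_def)
  show inj_lab: "inj_on lab (edge_pairs n)"
  proof (rule inj_onI, clarify)
    fix u v x y
    assume "(u, v) \<in> edge_pairs n" "(x, y) \<in> edge_pairs n" "lab (u, v) = lab (x, y)"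
    then show "u = x \<and> v = y"
      using distinct[of u v x y] by (auto simp: edge_pairs_iff doubleton_eq_iff)
  qed
  have "lab (u, v) \<in> {1..int (2 * n - 3)}" if "(u, v) \<in> edge_pairs n" for u v
  proof -
    have uv: "u < n" "v < n" "u \<noteq> v" using that by (auto simp: edge_pairs_iff adj_def)
    then have "g u \<noteq> g v" "g u \<le> 2 * n - 3" "g v \<le> 2 * n - 3"
      using graceful_inj[OF assms(2)] graceful_le[OF assms(1,2)] by auto
    then show ?thesis by (auto simp: lab_def)
  qed
  then have "lab ` edge_pairs n \<subseteq> {1..int (2 * n - 3)}" by auto
  moreover have "card (lab ` edge_pairs n) = card {1..int (2 * n - 3)}"
    using card_image[OF inj_lab] card_edge_pairs[OF assms(1)] by simp
  ultimately show "lab ` edge_pairs n = {1..int (2 * n - 3)}"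
    by (simp add: card_subset_eq)
qed

text \<open>The edge label \<open>2 * n - 3\<close> occurs, and only the vertex labels
  \<open>0\<close> and \<open>2 * n - 3\<close> can produce it. By injectivity the endpoints of that
  edge are \<open>u\<close> and \<open>v\<close>.\<close>

lemma graceful_extremes_adjacent:
  assumes "n \<ge> 2" "graceful_labeling (path_square n) g"
    and "u < n" "v < n" "g u = 0" "g v = 2 * n - 3"
  shows "adj n u v"
proof -
  have "int (2 * n - 3) \<in> {1..int (2 * n - 3)}" using assms(1) by auto
  then obtain x y where xy: "(x, y) \<in> edge_pairs n"
    and lab: "\<bar>int (g x) - int (g y)\<bar> = int (2 * n - 3)"
    unfolding graceful_edge_labels(2)[OF assms(1,2), symmetric] by auto
  have adj: "adj n x y" "adj n y x" using xy by (auto simp: edge_pairs_iff adj_def)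
  then have "x < n" "y < n" by (auto simp: adj_def)
  then have "g x \<le> 2 * n - 3" "g y \<le> 2 * n - 3"
    using graceful_le[OF assms(1,2)] by auto
  with lab have "g x = 0 \<and> g y = 2 * n - 3 \<or> g y = 0 \<and> g x = 2 * n - 3" by linarith
  then show ?thesis
    using assms(3-6) adj \<open>x < n\<close> \<open>y < n\<close> graceful_inj[OF assms(2)] by metis
qed

text \<open>In the square of the path only the vertices \<open>1\<close> and \<open>n - 2\<close> have odd degree, so they
  decide the parity of the sum of all edge labels.\<close>

lemma graceful_parity:
  assumes "n \<ge> 4" "graceful_labeling (path_square n) g"
  shows "odd (g 1 + g (n - 2) + n)"
proof -
  define lab where "lab = (\<lambda>(u, v). \<bar>int (g u) - int (g v)\<bar>)"
  define deg where "deg = (\<lambda>(u, v). int (g u) + int (g v))"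
  have n2: "n \<ge> 2" using assms(1) by simp
  have "sum lab (edge_pairs n) = (\<Sum>k\<in>{1..int (2 * n - 3)}. k)"
    using graceful_edge_labels[OF n2 assms(2)]
    by (subst sum.reindex_cong[of lab "edge_pairs n" _ "\<lambda>k. k"]) (auto simp: lab_def)
  also have "\<dots> = (int n - 1) * (2 * int n - 3)"
  proof -
    have "2 * (\<Sum>k\<in>{1..int N}. k) = int N * (int N + 1)" for N
    proof (induction N)
      case (Suc N)
      have "{1..int (Suc N)} = insert (int N + 1) {1..int N}" by auto
      with Suc show ?case by (simp add: algebra_simps)
    qed simp
    from this[of "2 * n - 3"] n2 assms(1) show ?thesis
      by (simp add: of_nat_diff algebra_simps)
  qed
  finally have lab_sum: "sum lab (edge_pairs n) = (int n - 1) * (2 * int n - 3)" .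
  \<comment> \<open>Modulo 2 the absolute difference is the sum, so the sum of edge labels has the
    parity of the vertex labels weighted by degree.\<close>
  have parity: "even (\<bar>int a - int b\<bar> - (int a + int b))" for a b :: nat
    by presburger
  have "even (sum lab (edge_pairs n) - sum deg (edge_pairs n))"
    unfolding sum_subtractf[symmetric] lab_def deg_def
    by (rule dvd_sum) (use parity in auto)
  \<comment> \<open>The degree is 2 at \<open>0\<close> and \<open>n - 1\<close>, 3 at
    \<open>1\<close> and \<open>n - 2\<close>, and 4 elsewhere; the formula subtracts the deficits
    from 4.\<close>
  moreover have "sum deg (edge_pairs n) = 4 * (\<Sum>i<n. int (g i)) - 2 * int (g 0) - int (g 1)
      - int (g (n - 2)) - 2 * int (g (n - 1))"
    using assms(1)
  proof (induction n rule: dec_induct)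
    case base
    show ?case by (simp add: sum_edge_pairs deg_def numeral_eq_Suc)
  next
    case (step k)
    have "k = Suc (Suc (k - 2))" using step.hyps by simp
    then obtain j where "k = Suc (Suc j)" by blast
    with step.IH show ?case by (simp add: sum_edge_pairs deg_def)
  qed
  \<comment> \<open>As \<open>2 * int n - 3\<close> is odd, the sum of all edge labels has the
    parity of \<open>n - 1\<close>.\<close>
  ultimately have "even ((int n - 1) * (2 * int n - 3) - (int (g 1) + int (g (n - 2))))"
    using lab_sum by simp
  then show ?thesis using assms(1) by simp
qed

text \<open>These are the two vertices of odd degree, not the end vertices of the path. Admitting
  both orders lets one lemma serve a position and its mirror image.\<close>

definition ends :: "nat \<Rightarrow> nat \<Rightarrow> nat \<Rightarrow> bool" where
  "ends n a b \<longleftrightarrow> a = 1 \<and> b = n - 2 \<or> a = n - 2 \<and> b = 1"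

lemma doomed_parity:
  assumes "n \<ge> 4" "ends n a b" "f a = Some k" "f b = Some l" "even (k + l + n)"
  shows "doomed n f"
  unfolding doomed_def
proof (rule notI, elim exE conjE)
  fix g assume g: "graceful_labeling (path_square n) g" and ext: "\<forall>v<n. \<forall>l. f v = Some l \<longrightarrow> g v = l"
  have "g a = k" "g b = l" using ext assms by (auto simp: ends_def)
  with graceful_parity[OF assms(1) g] assms(2,5) show False
    by (auto simp: ends_def add.commute)
qed

lemma doomed_extremes:
  assumes "n \<ge> 2" "u < n" "v < n" "\<not> adj n u v" "f u = Some k" "f v = Some (2 * n - 3 - k)"
    "k = 0 \<or> k = 2 * n - 3"
  shows "doomed n f"
  unfolding doomed_def
proof (rule notI, elim exE conjE)
  fix g assume g: "graceful_labeling (path_square n) g" and ext: "\<forall>v<n. \<forall>l. f v = Some l \<longrightarrow> g v = l"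
  have "g u = k" "g v = 2 * n - 3 - k" using ext assms by auto
  then show False
    using graceful_extremes_adjacent[OF assms(1) g, of u v] graceful_extremes_adjacent[OF assms(1) g, of v u]
      assms(2-4,7) by (auto simp: adj_sym)
qed

section \<open>Legal moves in a partial labeling\<close>

lemma okay_upd:
  assumes "okay n f" "f v = None"
    and new: "\<And>u x y a c d. f u = Some a \<Longrightarrow> adj n v u \<Longrightarrow> f x = Some c \<Longrightarrow> f y = Some d \<Longrightarrow> adj n x y \<Longrightarrow>
      \<bar>int l - int a\<bar> \<noteq> \<bar>int c - int d\<bar>"
    and pair: "\<And>u u' a a'. f u = Some a \<Longrightarrow> f u' = Some a' \<Longrightarrow> adj n v u \<Longrightarrow> adj n v u' \<Longrightarrow> u \<noteq> u' \<Longrightarrow>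
      \<bar>int l - int a\<bar> \<noteq> \<bar>int l - int a'\<bar>"
  shows "okay n (f(v \<mapsto> l))"
  unfolding okay_def
proof (intro allI impI)
  fix p q x y a b c d
  let ?f = "f(v \<mapsto> l)"
  assume f: "?f p = Some a" "?f q = Some b" "?f x = Some c" "?f y = Some d"
    and adj: "adj n p q" "adj n x y" and ne: "{p, q} \<noteq> {x, y}"
  have old: "\<bar>int a - int b\<bar> \<noteq> \<bar>int c - int d\<bar>"
    if "f p = Some a" "f q = Some b" "f x = Some c" "f y = Some d" 
    using assms(1) that adj ne unfolding okay_def by blast
  have irr: "p \<noteq> q" "x \<noteq> y" using adj by (auto simp: adj_def)
  note sym = adj_sym[of n _ v]
  show "\<bar>int a - int b\<bar> \<noteq> \<bar>int c - int d\<bar>"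
  \<comment> \<open>Only edges at \<open>v\<close> gain a label. A clash therefore involves two
    edges at \<open>v\<close> (excluded by \<open>pair\<close>), one edge at \<open>v\<close> and an
    older edge (excluded by \<open>new\<close>), or two older edges.\<close>
  proof (cases "p = v \<or> q = v")
    case True
    then obtain u k where u: "f u = Some k" "adj n v u" "{p, q} = {v, u}"
      and k: "\<bar>int a - int b\<bar> = \<bar>int l - int k\<bar>"
      using f(1,2) adj(1) irr sym by (auto split: if_splits simp: abs_minus_commute)
    show ?thesis
    proof (cases "x = v \<or> y = v")
      case True
      then obtain u' k' where u': "f u' = Some k'" "adj n v u'" "{x, y} = {v, u'}"
        and k': "\<bar>int c - int d\<bar> = \<bar>int l - int k'\<bar>"
        using f(3,4) adj(2) irr sym by (auto split: if_splits simp: abs_minus_commute)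
      with ne u have "u \<noteq> u'" by auto
      with pair[OF u(1) u'(1)] u(2) u'(2) k k' show ?thesis by simp
    next
      case False
      with f(3,4) new[OF u(1,2), of x c y d] adj(2) k show ?thesis by simp
    qed
  next
    case pq: False
    show ?thesis
    proof (cases "x = v \<or> y = v")
      case True
      then obtain u k where u: "f u = Some k" "adj n v u"
        and k: "\<bar>int c - int d\<bar> = \<bar>int l - int k\<bar>"
        using f(3,4) adj(2) irr sym by (auto split: if_splits simp: abs_minus_commute)
      with pq f(1,2) new[OF u(1,2), of p a q b] adj(1) k show ?thesis by simp
    next
      case False
      with pq f old show ?thesis by simp
    qed
  qed
qed

text \<open>With at most one labeled neighbour of \<open>v\<close>, no two new edge labels can
  clash; a single edge label has to be compared with the older ones.\<close>

lemma okay_upd_leaf: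
  assumes "okay n f" "f v = None" "f w = Some a"
    and "\<And>u b. f u = Some b \<Longrightarrow> adj n v u \<Longrightarrow> u = w"
    and "\<And>x y c d. f x = Some c \<Longrightarrow> f y = Some d \<Longrightarrow> adj n x y \<Longrightarrow> \<bar>int l - int a\<bar> \<noteq> \<bar>int c - int d\<bar>"
  shows "okay n (f(v \<mapsto> l))"
proof (rule okay_upd[OF assms(1,2)])
  fix u x y b c d
  assume "f u = Some b" "adj n v u" "f x = Some c" "f y = Some d" "adj n x y"
  with assms(3) assms(4)[of u] assms(5)[of x c y d] show "\<bar>int l - int b\<bar> \<noteq> \<bar>int c - int d\<bar>" by auto
next
  fix u u' b b'
  assume "f u = Some b" "f u' = Some b'" "adj n v u" "adj n v u'" "u \<noteq> u'"
  with assms(4)[of u] assms(4)[of u'] show "\<bar>int l - int b\<bar> \<noteq> \<bar>int l - int b'\<bar>" by auto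
qed

lemma legal_first_move: "v < n \<Longrightarrow> l \<le> 2 * n - 3 \<Longrightarrow> legal n Map.empty v l"
  by (auto simp: legal_def okay_def adj_def split: if_splits)

lemma legal_second_move:
  assumes "v < n" "w \<noteq> v" "k \<le> 2 * n - 3" "k \<noteq> l"
  shows "legal n [w \<mapsto> l] v k"
proof -
  have "okay n [w \<mapsto> l]"
    by (auto simp: okay_def adj_def split: if_splits)
  then have "okay n ([w \<mapsto> l](v \<mapsto> k))"
    using assms by (intro okay_upd[of n "[w \<mapsto> l]"]) (auto simp: adj_def split: if_splits)
  with assms show ?thesis by (auto simp: legal_def)
qed

lemma legal_isolated:
  assumes "okay n f" "v < n" "f v = None" "l \<le> 2 * n - 3" "l \<notin> ran f"
    and "\<And>u a. f u = Some a \<Longrightarrow> \<not> adj n v u"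
  shows "legal n f v l"
  unfolding legal_def using assms by (auto intro: okay_upd)

text \<open>Each parity class contains \<open>n - 1\<close> of the labels up to
  \<open>2 * n - 3\<close>, more than \<open>xs\<close> can exclude.\<close>

lemma ex_label_of_parity:
  assumes "length xs + 2 \<le> n"
  shows "\<exists>r \<le> 2 * n - 3. even (r + p) \<and> r \<notin> set xs"
proof -
  let ?h = "\<lambda>i. 2 * i + p mod 2"
  have "\<not> ?h ` {..<n - 1} \<subseteq> set xs"
  proof
    assume "?h ` {..<n - 1} \<subseteq> set xs"
    then have "card (?h ` {..<n - 1}) \<le> length xs"
      by (meson List.finite_set card_length card_mono le_trans)
    moreover have "card (?h ` {..<n - 1}) = n - 1"
      by (subst card_image) (auto simp: inj_on_def)
    ultimately show False using assms by simp
  qed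
  then obtain i where i: "i < n - 1" "?h i \<notin> set xs" by auto
  have "?h i \<le> 2 * n - 3" using i(1) by presburger
  moreover have "even (?h i + p)" by presburger
  ultimately show ?thesis using i(2) by blast
qed

section \<open>Bob's winning replies and opening for general \<open>n\<close>\<close>

lemma bob_wins_by_move: "legal n f v l \<Longrightarrow> doomed n (f(v \<mapsto> l)) \<Longrightarrow> bob_wins n True f"
  by (blast intro: bob_wins.bob bob_wins.doomed)

lemma bob_wins_end_vertex:
  assumes "n \<ge> 4" "ends n w b"
  shows "bob_wins n True [w \<mapsto> l]"
proof -
  obtain r where r: "r \<le> 2 * n - 3" "even (r + (l + n))" "r \<notin> set [l]"
    using assms(1) ex_label_of_parity[of "[l]" n "l + n"] by auto
  have wb: "b < n" "w \<noteq> b" using assms by (auto simp: ends_def)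
  show ?thesis
    by (rule bob_wins_by_move[of n _ b r])
      (use r wb assms doomed_parity[of n w b "[w \<mapsto> l, b \<mapsto> r]" l r] in
        \<open>auto intro: legal_second_move simp: ac_simps\<close>)
qed

text \<open>Bob puts the opposite extreme label on the vertex \<open>u\<close>, which is not
  adjacent to \<open>w\<close>.\<close>

lemma bob_wins_extreme_label:
  assumes "n \<ge> 2" "l = 0 \<or> l = 2 * n - 3" "w < n" "u < n" "w \<noteq> u" "\<not> adj n w u"
  shows "bob_wins n True [w \<mapsto> l]"
  by (rule bob_wins_by_move[of n _ u "2 * n - 3 - l"])
    (use assms in \<open>auto intro!: legal_second_move doomed_extremes[of n w u _ l]\<close>)

text \<open>Bob opens with \<open>0\<close> on vertex \<open>1\<close>. If Alice does not answer at
  \<open>n - 2\<close>, Bob spoils the parity there. If she does, Bob puts \<open>2 * n - 3\<close>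
  on \<open>n - 1\<close>, unless she has used that label herself and thereby doomed the position.
  For \<open>n \<ge> 6\<close> the vertices \<open>1\<close> and \<open>n - 2\<close> are not
  adjacent.\<close>

lemma bob_wins_bob_first:
  assumes "n \<ge> 6"
  shows "bob_wins n True Map.empty"
proof (rule bob_wins.bob)
  show "legal n Map.empty 1 0" using assms by (intro legal_first_move) auto
  show "bob_wins n False [1 \<mapsto> 0]"
  proof (rule bob_wins.alice[of 0])
    fix w l assume leg: "legal n [1 \<mapsto> 0] w l"
    then have w: "w < n" "w \<noteq> 1" "l \<le> 2 * n - 3" "l \<noteq> 0" and ok: "okay n [1 \<mapsto> 0, w \<mapsto> l]"
      by (auto simp: legal_def split: if_splits)
    show "bob_wins n True [1 \<mapsto> 0, w \<mapsto> l]"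
    proof (cases "w = n - 2")
      case True
      show ?thesis
      proof (cases "l = 2 * n - 3")
        case max: True
        show ?thesis
          by (rule bob_wins.doomed, rule doomed_extremes[of n 1 w _ 0])
            (use True max w assms in \<open>auto simp: adj_def\<close>)
      next
        case False
        have "okay n ([1 \<mapsto> 0, w \<mapsto> l](n - 1 \<mapsto> 2 * n - 3))"
          by (rule okay_upd[OF ok]) (use True assms in \<open>auto simp: adj_def split: if_splits\<close>)
        then have "legal n [1 \<mapsto> 0, w \<mapsto> l] (n - 1) (2 * n - 3)"
          using True False w assms by (auto simp: legal_def)
        then show ?thesis
          by (rule bob_wins_by_move)
            (use True assms in \<open>auto intro!: doomed_extremes[of n 1 "n - 1" _ 0] simp: adj_def\<close>)
      qed
    next
      case False
      \<comment> \<open>If \<open>w\<close> is adjacent to \<open>1\<close>, that edge has label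
        \<open>l\<close>; an edge from \<open>w\<close> to \<open>n - 2\<close> would repeat it
        exactly for \<open>r = 0\<close> or \<open>r = 2 * l\<close>.\<close>
      obtain r where r: "r \<le> 2 * n - 3" "even (r + n)" "r \<notin> set [0, l, 2 * l]"
        using assms ex_label_of_parity[of "[0, l, 2 * l]" n n] by auto
      have "okay n ([1 \<mapsto> 0, w \<mapsto> l](n - 2 \<mapsto> r))"
      proof (rule okay_upd_leaf[OF ok, of _ w l])
        fix x y c d
        assume "[1 \<mapsto> 0, w \<mapsto> l] x = Some c" "[1 \<mapsto> 0, w \<mapsto> l] y = Some d" "adj n x y"
        then have "\<bar>int c - int d\<bar> = int l"
          by (auto simp: adj_def split: if_splits)
        with r(3) show "\<bar>int r - int l\<bar> \<noteq> \<bar>int c - int d\<bar>" by auto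
      qed (use False assms in \<open>auto simp: adj_def split: if_splits\<close>)
      then have "legal n [1 \<mapsto> 0, w \<mapsto> l] (n - 2) r"
        using False w r assms by (auto simp: legal_def)
      then show ?thesis
        by (rule bob_wins_by_move)
          (use False w r assms in \<open>auto intro!: doomed_parity[of n 1 "n - 2" _ 0 r] simp: ends_def\<close>)
    qed
  qed (use assms in auto)
qed

text \<open>The label \<open>c\<close> is chosen so that a reply at \<open>B\<close> of the parity required by
  \<open>graceful_parity\<close> cannot make the answer \<open>2 * n - 3 - c\<close> at \<open>D\<close> repeat the edge label
  between \<open>A\<close> and \<open>w\<close>.\<close>

lemma bob_wins_two_threats:
  assumes n: "n \<ge> 7" and AB: "ends n A B"
    and D: "D < n" "D \<noteq> A" "D \<noteq> B" and w: "w < n" "w \<noteq> A" "w \<noteq> B" "w \<noteq> D"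
    and far: "\<not> adj n A B" "\<not> adj n A D" "\<not> adj n B w" "\<not> adj n D w"
    and common: "n = 7 \<or> (\<forall>x. adj n A x \<longrightarrow> \<not> adj n B x)"
    and l: "0 < l" "l < 2 * n - 3"
  shows "bob_wins n True [w \<mapsto> l]"
proof -
  define c where "c = (if even (l + n) then 2 * n - 3 else 0)"
  have c: "c = 0 \<or> c = 2 * n - 3" "c \<noteq> l" "c \<le> 2 * n - 3" "odd (l + c + n)"
    using n l by (auto simp: c_def)
  have A: "A < n" "B < n" "A \<noteq> B" using AB n by (auto simp: ends_def)
  \<comment> \<open>The label of the edge between \<open>A\<close> and \<open>w\<close>, if these
    are adjacent.\<close>
  define e where "e = (if c = 0 then l else 2 * n - 3 - l)"
  have e: "\<bar>int c - int l\<bar> = int e" using c(1) l by (auto simp: e_def)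
  show ?thesis
  proof (rule bob_wins.bob)
    show "legal n [w \<mapsto> l] A c" using A c w by (intro legal_second_move) auto
    show "bob_wins n False [w \<mapsto> l, A \<mapsto> c]"
    proof (rule bob_wins.alice[of D])
      fix x r assume leg: "legal n [w \<mapsto> l, A \<mapsto> c] x r"
      let ?f = "[w \<mapsto> l, A \<mapsto> c, x \<mapsto> r]"
      have x: "x < n" "x \<noteq> A" "x \<noteq> w" "r \<noteq> c" "r \<noteq> l" "r \<le> 2 * n - 3" and ok: "okay n ?f"
        using leg w(2) by (auto simp: legal_def split: if_splits)
      have dom: "u = w \<and> k = l \<or> u = A \<and> k = c \<or> u = x \<and> k = r" if "?f u = Some k" for u k
        using that by (auto split: if_splits)
      have ran: "ran ?f \<subseteq> {l, c, r}" using dom unfolding ran_def by blast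
      have f: "?f w = Some l" "?f A = Some c" "?f x = Some r" using x w by auto
      show "bob_wins n True ?f"
      \<comment> \<open>Bob now threatens the opposite extreme label at \<open>D\<close>, which is
        not adjacent to \<open>A\<close>, and a label of the wrong parity at \<open>B\<close>. If
        Alice replies at \<open>B\<close>, either her label already dooms the position or Bob plays
        at \<open>D\<close>; after any other reply Bob plays at \<open>B\<close>.\<close>
      proof (cases "x = B")
        case True
        show ?thesis
        proof (cases "even (c + r + n) \<or> r = 2 * n - 3 - c")
          case True
          then have "doomed n ?f"
            using doomed_parity[of n A B ?f c r] doomed_extremes[of n A B ?f c] \<open>x = B\<close> f n AB A c far
            by auto
          then show ?thesis by (rule bob_wins.doomed)
        next
          case False
          have "okay n (?f(D \<mapsto> 2 * n - 3 - c))"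
          proof (rule okay_upd_leaf[OF ok _ f(3)])
            fix p q i j
            assume pq: "?f p = Some i" "?f q = Some j" "adj n p q"
            have "\<bar>int i - int j\<bar> = int e"
              using dom[OF pq(1)] dom[OF pq(2)] pq(3) far \<open>x = B\<close> e
              by (auto simp: adj_sym abs_minus_commute)
            \<comment> \<open>Among \<open>w\<close>, \<open>A\<close> and \<open>B\<close> only
              \<open>A\<close> and \<open>w\<close> can be adjacent, so \<open>e\<close> is the only
              older edge label. A clash forces \<open>r = 2 * n - 3 - l\<close>, so
              \<open>r + l\<close> is odd; as \<open>l + c + n\<close> is odd,
              \<open>c + r + n\<close> is even, which is the case already settled.\<close>
            moreover have "\<bar>int (2 * n - 3 - c) - int r\<bar> \<noteq> int e"
            proof
              assume "\<bar>int (2 * n - 3 - c) - int r\<bar> = int e"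
              then have "r = 2 * n - 3 - l" using c(1) l x n by (auto simp: e_def split: if_splits)
              then have "r + l + 3 = 2 * n" using l by simp
              then have "odd (r + l)" by presburger
              then show False using c(4) False by auto
            qed
            ultimately show "\<bar>int (2 * n - 3 - c) - int r\<bar> \<noteq> \<bar>int i - int j\<bar>" by simp
          next
            fix u b assume "?f u = Some b" "adj n D u"
            then show "u = x" using dom[of u b] far by (auto simp: adj_sym)
          qed (use D w \<open>x = B\<close> in auto)
          moreover have "2 * n - 3 - c \<notin> ran ?f"
          proof -
            have "2 * n - 3 - c \<notin> {l, c, r}" using c(1) False l by auto
            with ran show ?thesis by blast
          qed
          ultimately have "legal n ?f D (2 * n - 3 - c)"
            using D w \<open>x = B\<close> by (simp add: legal_def)
          moreover have "doomed n (?f(D \<mapsto> 2 * n - 3 - c))"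
            using doomed_extremes[of n A D "?f(D \<mapsto> 2 * n - 3 - c)" c] n A D far c f by auto
          ultimately show ?thesis by (rule bob_wins_by_move)
        qed
      next
        case xB: False
        have win: "bob_wins n True ?f" if "legal n ?f B r'" "even (r' + (c + n))" for r'
        proof (rule bob_wins_by_move[OF that(1)])
          show "doomed n (?f(B \<mapsto> r'))"
            using doomed_parity[of n A B "?f(B \<mapsto> r')" c r'] n AB A f that(2) by auto
        qed
        show ?thesis
        proof (cases "adj n B x")
          case False
          obtain r' where r': "r' \<le> 2 * n - 3" "even (r' + (c + n))" "r' \<notin> set [l, c, r]"
            using n ex_label_of_parity[of "[l, c, r]" n "c + n"] by auto
          have "legal n ?f B r'"
          proof (rule legal_isolated[OF ok])
            show "r' \<notin> ran ?f" using ran r'(3) by auto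
            fix u k assume "?f u = Some k"
            then show "\<not> adj n B u" using dom[of u k] far False by (auto simp: adj_sym)
          qed (use A xB w r' in auto)
          then show ?thesis using r'(2) by (rule win)
        next
          case True
          \<comment> \<open>The entries exclude used labels and repetitions of the edge labels
            \<open>e\<close> and \<open>\<bar>int l - int r\<bar>\<close>; truncated subtraction at
            worst excludes \<open>0\<close> as well. For \<open>n = 7\<close> there is room for only
            five entries, but then the parity condition makes \<open>r' + c\<close> odd and so rules
            out \<open>c\<close> by itself.\<close>
          define xs where "xs = [l, r, 2 * r - l, r + e, r - e] @ (if n = 7 then [] else [c])"
          have "length xs + 2 \<le> n" using n by (auto simp: xs_def)
          then obtain r' where r': "r' \<le> 2 * n - 3" "even (r' + (c + n))" "r' \<notin> set xs"
            using ex_label_of_parity by blast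
          have r'c: "r' \<noteq> c" using r'(2,3) by (cases "n = 7") (auto simp: xs_def)
          have "okay n (?f(B \<mapsto> r'))"
          proof (rule okay_upd_leaf[OF ok _ f(3)])
            fix p q i j
            assume pq: "?f p = Some i" "?f q = Some j" "adj n p q"
            have "\<bar>int i - int j\<bar> = int e \<or> \<bar>int i - int j\<bar> = \<bar>int l - int r\<bar> \<or>
                n = 7 \<and> \<bar>int i - int j\<bar> = \<bar>int c - int r\<bar>"
              using dom[OF pq(1)] dom[OF pq(2)] pq(3) common True e
              by (auto simp: adj_sym abs_minus_commute)
            moreover have "\<bar>int r' - int r\<bar> \<noteq> int e" "\<bar>int r' - int r\<bar> \<noteq> \<bar>int l - int r\<bar>"
              using r'(3) by (auto simp: xs_def)
            \<comment> \<open>For \<open>n = 7\<close>, vertex \<open>3\<close> is adjacent to both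
              \<open>A\<close> and \<open>B\<close>, so the edge from \<open>A\<close> to
              \<open>x\<close> may be labeled too. Repeating its label would make
              \<open>r' + c\<close> even, against the chosen parity.\<close>
            moreover have "\<bar>int r' - int r\<bar> \<noteq> \<bar>int c - int r\<bar>" if "n = 7"
            proof
              assume "\<bar>int r' - int r\<bar> = \<bar>int c - int r\<bar>"
              then have "r' = c \<or> r' + c = 2 * r" by linarith
              then have "even (r' + c)" by presburger
              then show False using r'(2) that by auto
            qed
            ultimately show "\<bar>int r' - int r\<bar> \<noteq> \<bar>int i - int j\<bar>" by auto
          next
            fix u b assume "?f u = Some b" "adj n B u"
            then show "u = x" using dom[of u b] far by (auto simp: adj_sym)
          qed (use A w xB in auto)
          moreover have "r' \<notin> ran ?f"
            using ran r'(3) r'c by (auto simp: xs_def)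
          ultimately have "legal n ?f B r'"
            using A w xB r'(1) by (simp add: legal_def)
          then show ?thesis using r'(2) by (rule win)
        qed
      qed
    qed (use D w in auto)
  qed
qed

text \<open>\<open>B\<close> is chosen as a vertex of odd degree not adjacent to \<open>w\<close>,
  and \<open>D\<close> as the end vertex beside \<open>B\<close>. For \<open>n = 7\<close> the
  middle vertex \<open>3\<close> admits no such choice, being adjacent to both \<open>1\<close> and
  \<open>5\<close>.\<close>

lemma bob_wins_inner_label:
  assumes "n \<ge> 7" "n = 7 \<longrightarrow> w \<noteq> 3" "w < n" "w \<noteq> 1" "w \<noteq> n - 2" "0 < l" "l < 2 * n - 3"
  shows "bob_wins n True [w \<mapsto> l]"
proof (cases "w \<le> n - 5")
  case True
  then show ?thesis
    using assms by (intro bob_wins_two_threats[of n 1 "n - 2" "n - 1"]) (auto simp: adj_def ends_def)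
next
  case False
  then show ?thesis
    using assms by (intro bob_wins_two_threats[of n "n - 2" 1 0]) (auto simp: adj_def ends_def)
qed

section \<open>Exhaustive search on short paths\<close>

text \<open>\<open>P\<close> holds the labels of the vertices visited so far, most recent first, \<open>E\<close> the edge
  labels used so far, and \<open>L\<close> the labels available at vertices for which the list in the last
  argument prescribes nothing.\<close>

fun stuck :: "int list \<Rightarrow> int list \<Rightarrow> int list \<Rightarrow> int option list \<Rightarrow> bool" where
  "stuck L P E [] = False"
| "stuck L P E (c # cs) = (\<forall>l\<in>set (case c of None \<Rightarrow> L | Some l \<Rightarrow> [l]). l \<in> set P \<or>
     (let N = map (\<lambda>a. \<bar>l - a\<bar>) (take 2 P)
      in \<not> distinct N \<or> (\<exists>e\<in>set N. e \<in> set E) \<or> stuck L (l # P) (N @ E) cs))"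

text \<open>Labels prescribed by \<open>f\<close> are withheld from the free vertices at once, as
  injectivity forbids them there; this prunes the search.\<close>

definition dead :: "nat \<Rightarrow> position \<Rightarrow> bool" where
  "dead n f = (let cs = map (\<lambda>v. map_option int (f v)) [0..<n]
     in stuck (filter (\<lambda>l. Some l \<notin> set cs) (map int [0..<2 * n - 2])) [] [] cs)"

text \<open>The two most recent labels belong to \<open>i - 1\<close> and \<open>i - 2\<close>, the
  only earlier neighbours of \<open>i\<close> in the square. The filter handles
  \<open>i < 2\<close>, where fewer exist.\<close>

lemma take_two_rev_map_upt:
  "take 2 (rev (map h [0..<i])) = map (\<lambda>d. h (i - d)) (filter (\<lambda>d. d \<le> i) [1, 2])"
proof (cases i)
  case (Suc j)
  then show ?thesis by (cases j) auto
qed simp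

text \<open>A graceful labeling extending \<open>f\<close> would be a branch along which the search
  never fails.\<close>

lemma doomed_if_dead:
  assumes "n \<ge> 2" "dead n f"
  shows "doomed n f"
  unfolding doomed_def
proof (rule notI, elim exE conjE)
  fix g assume g: "graceful_labeling (path_square n) g" and ext: "\<forall>v<n. \<forall>l. f v = Some l \<longrightarrow> g v = l"
  define cs where "cs = map (\<lambda>v. map_option int (f v)) [0..<n]"
  define L where "L = filter (\<lambda>l. Some l \<notin> set cs) (map int [0..<2 * n - 2])"
  define lab where "lab u v = \<bar>int (g u) - int (g v)\<bar>" for u v
  note inj = graceful_inj[OF g] and range = graceful_le[OF assms(1) g]
    and distinct = graceful_distinct[OF g, folded lab_def]
  \<comment> \<open>Invariant along this branch: the first \<open>i\<close> vertices carry the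
    labels given by \<open>g\<close>, and \<open>E\<close> contains only labels of edges among
    them.\<close>
  have "\<not> stuck L (rev (map (\<lambda>v. int (g v)) [0..<i])) E (drop i cs)"
    if "i \<le> n" "\<forall>e\<in>set E. \<exists>u v. e = lab u v \<and> adj n u v \<and> u < i \<and> v < i" for i E
    using that
  proof (induction "n - i" arbitrary: i E)
    case 0
    then show ?case by (simp add: cs_def)
  next
    case (Suc k)
    then have i: "i < n" by simp
    let ?P = "rev (map (\<lambda>v. int (g v)) [0..<i])"
    define N where "N = map (\<lambda>a. \<bar>int (g i) - a\<bar>) (take 2 ?P)"
    have N: "N = map (\<lambda>d. lab i (i - d)) (filter (\<lambda>d. d \<le> i) [1, 2])"
      unfolding N_def take_two_rev_map_upt by (simp add: lab_def)
    have N_adj: "\<exists>u v. e = lab u v \<and> adj n u v \<and> u = i \<and> v < i" if "e \<in> set N" for e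
      using that i unfolding N by (force simp: adj_def split: if_splits)
    have "drop i cs = cs ! i # drop (Suc i) cs"
      using i by (intro Cons_nth_drop_Suc[symmetric]) (simp add: cs_def)
    moreover have "int (g i) \<in> set (case cs ! i of None \<Rightarrow> L | Some l \<Rightarrow> [l])"
    proof (cases "f i")
      case None
      have "Some (int (g i)) \<notin> set cs"
      proof
        assume "Some (int (g i)) \<in> set cs"
        then obtain v where "v < n" "f v = Some (g i)"
          by (auto simp: cs_def dest!: sym[of "Some _"])
        with ext inj[of v i] i None show False by auto
      qed
      moreover have "g i < 2 * n - 2" using range[OF i] assms(1) by simp
      ultimately show ?thesis using None i by (auto simp: L_def cs_def)
    next
      case (Some l)
      with ext i show ?thesis by (simp add: cs_def)
    qed
    moreover have "int (g i) \<notin> set ?P" using i inj by auto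
    moreover have "distinct N"
    proof (cases "i \<ge> 2")
      case True
      then have "adj n i (i - 1)" "adj n i (i - 2)" "{i, i - 1} \<noteq> {i, i - 2}"
        using i by (auto simp: adj_def doubleton_eq_iff)
      then show ?thesis using distinct unfolding N by auto
    qed (auto simp: N)
    moreover have "e \<notin> set E" if e: "e \<in> set N" for e
    proof
      assume "e \<in> set E"
      with Suc.prems(2) obtain u v where "e = lab u v" "adj n u v" "u < i" "v < i" by blast
      moreover from N_adj[OF e] obtain v' where "e = lab i v'" "adj n i v'" by blast
      ultimately show False using distinct[of u v i v'] by (auto simp: doubleton_eq_iff)
    qed
    moreover have "\<not> stuck L (int (g i) # ?P) (N @ E) (drop (Suc i) cs)"
    proof -
      have "\<forall>e\<in>set (N @ E). \<exists>u v. e = lab u v \<and> adj n u v \<and> u < Suc i \<and> v < Suc i"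
      proof
        fix e assume "e \<in> set (N @ E)"
        then consider "e \<in> set N" | "e \<in> set E" by auto
        then show "\<exists>u v. e = lab u v \<and> adj n u v \<and> u < Suc i \<and> v < Suc i"
        proof cases
          case 1
          from N_adj[OF this] show ?thesis by (metis less_Suc_eq)
        next
          case 2
          with Suc.prems(2) show ?thesis by (metis less_SucI)
        qed
      qed
      with Suc.hyps(1)[of "Suc i" "N @ E"] Suc.hyps(2) i show ?thesis by simp
    qed
    ultimately show ?case by (auto simp: Let_def N_def)
  qed
  from this[of 0 "[]"] assms(2) show False
    by (simp add: dead_def cs_def L_def Let_def)
qed

lemma bob_wins_if_dead_reply:
  assumes "n \<ge> 2" "v < n" "v \<noteq> w" "k \<le> 2 * n - 3" "k \<noteq> l" "dead n [w \<mapsto> l, v \<mapsto> k]"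
  shows "bob_wins n True [w \<mapsto> l]"
  using assms by (intro bob_wins_by_move legal_second_move doomed_if_dead) auto

text \<open>Each pair \<open>(w, v)\<close> below says where Bob answers a label at \<open>w\<close>; the answers were found by
  computer search.\<close>

lemma dead_replies_4: "\<forall>(w, v)\<in>set [(0, 1), (3, 0)]. \<forall>l\<in>set [1..<5]. dead 4 [w \<mapsto> l, v \<mapsto> 5 - l]"
  by code_simp

lemma dead_replies_5:
  "\<forall>(w, v)\<in>set [(0, 3), (2, 1), (4, 1)]. \<forall>l\<in>set [1..<7]. dead 5 [w \<mapsto> l, v \<mapsto> 7 - l]"
  by code_simp

lemma dead_replies_6:
  "\<forall>(w, v)\<in>set [(0, 3), (2, 1), (3, 0), (5, 2)]. \<forall>l\<in>set [1..<9]. dead 6 [w \<mapsto> l, v \<mapsto> 9 - l]"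
  by code_simp

text \<open>This settles the middle vertex of the path on seven vertices, which
  \<open>bob_wins_inner_label\<close> leaves out. Bob creates the edge label 1 next to it.\<close>

lemma dead_replies_7:
  "\<forall>l\<in>set [1..<11]. dead 7 [3 \<mapsto> l, 2 \<mapsto> if l \<le> 5 then l + 1 else l - 1]"
  by code_simp

text \<open>Bob's opening for \<open>n = 5\<close>: one label is enough to doom the
  position.\<close>

lemma dead_middle_5: "dead 5 [2 \<mapsto> 3]"
  by code_simp

definition edge_val :: "position \<Rightarrow> nat \<times> nat \<Rightarrow> int option" where
  "edge_val f = (\<lambda>(u, v). case f u of None \<Rightarrow> None | Some a \<Rightarrow>
     (case f v of None \<Rightarrow> None | Some b \<Rightarrow> Some \<bar>int a - int b\<bar>))"

definition edge_list :: "nat \<Rightarrow> (nat \<times> nat) list" where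
  "edge_list n = map (\<lambda>i. (i, i + 1)) [0..<n - 1] @ map (\<lambda>i. (i, i + 2)) [0..<n - 2]"

text \<open>The quantifiers of \<open>okay\<close> range over all naturals. For evaluation the edges
  are enumerated once each, so that \<open>p = q\<close> expresses equality of edges.\<close>

definition legal_exec :: "nat \<Rightarrow> position \<Rightarrow> nat \<Rightarrow> nat \<Rightarrow> bool" where
  "legal_exec n f v l \<longleftrightarrow> v < n \<and> f v = None \<and> l \<le> 2 * n - 3 \<and> (\<forall>u\<in>set [0..<n]. f u \<noteq> Some l) \<and>
     (\<forall>p\<in>set (edge_list n). \<forall>q\<in>set (edge_list n). p = q \<or>
        edge_val (f(v \<mapsto> l)) p = None \<or> edge_val (f(v \<mapsto> l)) p \<noteq> edge_val (f(v \<mapsto> l)) q)"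

definition refutes :: "nat \<Rightarrow> position \<Rightarrow> (nat \<times> nat) list \<Rightarrow> bool" where
  "refutes n f T \<longleftrightarrow> (\<forall>v\<in>set [0..<n]. \<forall>l\<in>set [0..<2 * n - 2].
     f v \<noteq> None \<or> (\<exists>u\<in>set [0..<n]. f u = Some l) \<or> dead n (f(v \<mapsto> l)) \<or>
     (\<exists>(v', l')\<in>set T. legal_exec n (f(v \<mapsto> l)) v' l' \<and> dead n (f(v \<mapsto> l, v' \<mapsto> l'))))"

lemma set_edge_list: "set (edge_list n) = edge_pairs n"
  by (auto simp: edge_list_def edge_pairs_def lessThan_atLeast0)

text \<open>The executable test looks for used labels only on vertices below \<open>n\<close>, hence
  the condition on the domain.\<close>

lemma legal_if_legal_exec:
  assumes "legal_exec n f v l" "dom f \<subseteq> {..<n}"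
  shows "legal n f v l"
proof -
  let ?f = "f(v \<mapsto> l)"
  have *: "edge_val ?f p \<noteq> edge_val ?f q"
    if "p \<in> edge_pairs n" "q \<in> edge_pairs n" "p \<noteq> q" "edge_val ?f p \<noteq> None" for p q
  proof -
    have "\<forall>p\<in>edge_pairs n. \<forall>q\<in>edge_pairs n. p = q \<or> edge_val ?f p = None \<or> edge_val ?f p \<noteq> edge_val ?f q"
      using assms(1) unfolding legal_exec_def set_edge_list by (elim conjE)
    from bspec[OF bspec[OF this that(1)] that(2)] that(3,4) show ?thesis by argo
  qed
  have "okay n ?f"
    unfolding okay_def
  proof (intro allI impI)
    fix u u' x y a b c d
    assume f: "?f u = Some a" "?f u' = Some b" "?f x = Some c" "?f y = Some d"
      and adj: "adj n u u'" "adj n x y" and ne: "{u, u'} \<noteq> {x, y}"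
    have ordered: "\<exists>p\<in>edge_pairs n. {fst p, snd p} = {s, t} \<and> edge_val ?f p = Some \<bar>int i - int j\<bar>"
      if "?f s = Some i" "?f t = Some j" "adj n s t" for s t i j
    proof (cases "s < t")
      case True
      then show ?thesis
        using that by (intro bexI[of _ "(s, t)"]) (auto simp: edge_pairs_iff edge_val_def)
    next
      case False
      with that(3) have "t < s" by (auto simp: adj_def)
      then show ?thesis
        using that by (intro bexI[of _ "(t, s)"])
          (auto simp: edge_pairs_iff edge_val_def abs_minus_commute adj_sym)
    qed
    from ordered[OF f(1,2) adj(1)] ordered[OF f(3,4) adj(2)]
    obtain p q where "p \<in> edge_pairs n" "{fst p, snd p} = {u, u'}" "edge_val ?f p = Some \<bar>int a - int b\<bar>"
      "q \<in> edge_pairs n" "{fst q, snd q} = {x, y}" "edge_val ?f q = Some \<bar>int c - int d\<bar>" by blast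
    with *[of p q] ne show "\<bar>int a - int b\<bar> \<noteq> \<bar>int c - int d\<bar>" by auto
  qed
  moreover have "l \<notin> ran f"
    using assms by (auto simp: legal_exec_def ran_def subset_iff domIff)
  ultimately show ?thesis using assms(1) by (simp add: legal_def legal_exec_def)
qed

lemma bob_wins_if_refutes:
  assumes "n \<ge> 2" "refutes n f T" "dom f \<subseteq> {..<n}" "v\<^sub>0 < n" "f v\<^sub>0 = None"
  shows "bob_wins n False f"
proof (rule bob_wins.alice[of v\<^sub>0])
  fix v l assume leg: "legal n f v l"
  then have v: "v < n" "f v = None" "\<not> (\<exists>u\<in>set [0..<n]. f u = Some l)"
    and mem: "v \<in> set [0..<n]" "l \<in> set [0..<2 * n - 2]"
    using assms(1) by (auto simp: legal_def ran_def)
  have "dead n (f(v \<mapsto> l)) \<or>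
    (\<exists>(v', l')\<in>set T. legal_exec n (f(v \<mapsto> l)) v' l' \<and> dead n (f(v \<mapsto> l, v' \<mapsto> l')))"
    using bspec[OF bspec[OF assms(2)[unfolded refutes_def] mem(1)] mem(2)] v(2,3) by argo
  then consider "dead n (f(v \<mapsto> l))" |
    v' l' where "legal_exec n (f(v \<mapsto> l)) v' l'" "dead n (f(v \<mapsto> l, v' \<mapsto> l'))"
    by blast
  then show "bob_wins n True (f(v \<mapsto> l))"
  proof cases
    case 1
    with assms(1) show ?thesis by (blast intro: bob_wins.doomed doomed_if_dead)
  next
    case 2
    have "dom (f(v \<mapsto> l)) \<subseteq> {..<n}" using assms(3) v(1) by auto
    with 2 assms(1) show ?thesis
      by (blast intro: bob_wins_by_move legal_if_legal_exec doomed_if_dead)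
  qed
qed (use assms in auto)

lemma refutes_4: "refutes 4 [1 \<mapsto> 1] [(0, 0), (3, 4)]"
  by code_simp

text \<open>These are Bob's answers to an extreme label on the middle vertex, which is adjacent to
  all others and so leaves no place for the nonadjacent extreme. The second position and its table
  arise from the first by complementing labels, \<open>l\<close> to \<open>7 - l\<close>.\<close>

lemma refutes_5:
  "refutes 5 [2 \<mapsto> 0, 1 \<mapsto> 2] [(0, 3), (4, 1)]" "refutes 5 [2 \<mapsto> 7, 1 \<mapsto> 5] [(0, 4), (4, 6)]"
  by code_simp+

section \<open>Bob's strategy for every \<open>n \<ge> 4\<close>\<close>

lemma bob_wins_if_dead_complement:
  assumes "n \<ge> 2" "v < n" "v \<noteq> w" "l < 2 * n - 3" "dead n [w \<mapsto> l, v \<mapsto> 2 * n - 3 - l]"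
  shows "bob_wins n True [w \<mapsto> l]"
proof -
  \<comment> \<open>The two labels add up to an odd number.\<close>
  have "2 * n - 3 - l \<noteq> l" using assms(4) by presburger
  with assms show ?thesis by (intro bob_wins_if_dead_reply[of n v]) auto
qed

lemma bob_wins_alice_first:
  assumes "n \<ge> 4"
  shows "bob_wins n False Map.empty"
proof (rule bob_wins.alice[of 0])
  fix w l assume "legal n Map.empty w l"
  then have w: "w < n" "l \<le> 2 * n - 3" by (auto simp: legal_def)
  \<comment> \<open>The cases are: a vertex of odd degree (parity), an extreme label with a vertex
    three steps away (nonadjacent extremes), an extreme label on the middle of five vertices
    (search), and an inner label (two threats, or search for short paths).\<close>
  consider "w = 1 \<or> w = n - 2"
    | "w \<noteq> 1" "w \<noteq> n - 2" "l = 0 \<or> l = 2 * n - 3" "n = 5 \<longrightarrow> w \<noteq> 2"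
    | "l = 0 \<or> l = 2 * n - 3" "n = 5" "w = 2"
    | "w \<noteq> 1" "w \<noteq> n - 2" "0 < l" "l < 2 * n - 3"
    using w(2) by linarith
  then show "bob_wins n True [w \<mapsto> l]"
  proof cases
    case 1
    then obtain b where "ends n w b" by (auto simp: ends_def)
    with assms show ?thesis by (rule bob_wins_end_vertex)
  next
    case 2
    show ?thesis
    proof (cases "w + 3 < n")
      case True
      then show ?thesis
        using w 2 assms by (intro bob_wins_extreme_label[of n l w "w + 3"]) (auto simp: adj_def)
    next
      case False
      then have "w \<ge> 3" using w 2 assms by linarith
      then show ?thesis
        using w 2 assms by (intro bob_wins_extreme_label[of n l w "w - 3"]) (auto simp: adj_def)
    qed
  next
    case 3
    define k :: nat where "k = (if l = 0 then 2 else 5)"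
    have "bob_wins 5 False [2 \<mapsto> l, 1 \<mapsto> k]"
      using 3 bob_wins_if_refutes[OF _ refutes_5(1), of 0] bob_wins_if_refutes[OF _ refutes_5(2), of 0]
      by (auto simp: k_def)
    moreover have "legal 5 [2 \<mapsto> l] 1 k"
      using 3 by (intro legal_second_move) (auto simp: k_def)
    ultimately show ?thesis using 3 by (auto intro: bob_wins.bob)
  next
    case 4
    consider "n = 4" | "n = 5" | "n = 6" | "n = 7" "w = 3" | "n \<ge> 7" "n = 7 \<longrightarrow> w \<noteq> 3"
      using assms by linarith
    then show ?thesis
    proof cases
      case 1
      then obtain v :: nat where v: "(w, v) \<in> set [(0, 1), (3, 0)]"
        using w(1) \<open>w \<noteq> 1\<close> \<open>w \<noteq> n - 2\<close> by (cases "w = 0") auto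
      moreover have "l \<in> set [1..<5]" using 1 4 by auto
      ultimately have "dead 4 [w \<mapsto> l, v \<mapsto> 5 - l]" using dead_replies_4 by fast
      with 1 v 4 show ?thesis by (intro bob_wins_if_dead_complement[of n v]) auto
    next
      case 2
      then obtain v :: nat where v: "(w, v) \<in> set [(0, 3), (2, 1), (4, 1)]"
        using w(1) \<open>w \<noteq> 1\<close> \<open>w \<noteq> n - 2\<close> by (cases "w = 0"; cases "w = 2") auto
      moreover have "l \<in> set [1..<7]" using 2 4 by auto
      ultimately have "dead 5 [w \<mapsto> l, v \<mapsto> 7 - l]" using dead_replies_5 by fast
      with 2 v 4 show ?thesis by (intro bob_wins_if_dead_complement[of n v]) auto
    next
      case 3
      then obtain v :: nat where v: "(w, v) \<in> set [(0, 3), (2, 1), (3, 0), (5, 2)]"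
        using w(1) \<open>w \<noteq> 1\<close> \<open>w \<noteq> n - 2\<close> by (cases "w = 0"; cases "w = 2"; cases "w = 3") auto
      moreover have "l \<in> set [1..<9]" using 3 4 by auto
      ultimately have "dead 6 [w \<mapsto> l, v \<mapsto> 9 - l]" using dead_replies_6 by fast
      with 3 v 4 show ?thesis by (intro bob_wins_if_dead_complement[of n v]) auto
    next
      case 4
      then have "l \<in> set [1..<11]" using \<open>0 < l\<close> \<open>l < 2 * n - 3\<close> by auto
      then have "dead 7 [3 \<mapsto> l, 2 \<mapsto> if l \<le> 5 then l + 1 else l - 1]"
        using dead_replies_7 by blast
      with 4 \<open>0 < l\<close> \<open>l < 2 * n - 3\<close> show ?thesis
        by (intro bob_wins_if_dead_reply[of n 2 _ "if l \<le> 5 then l + 1 else l - 1"]) auto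
    next
      case 5
      with w \<open>w \<noteq> 1\<close> \<open>w \<noteq> n - 2\<close> \<open>0 < l\<close> \<open>l < 2 * n - 3\<close> show ?thesis
        by (intro bob_wins_inner_label)
    qed
  qed
qed (use assms in auto)

text \<open>When Bob starts and \<open>n \<le> 5\<close>, the vertices \<open>1\<close> and
  \<open>n - 2\<close> are adjacent, so the general opening is replaced by ones settled by
  search.\<close>

lemma bob_wins_path_square:
  assumes "n \<ge> 4"
  shows "bob_wins n t Map.empty"
proof (cases t)
  case True
  consider "n = 4" | "n = 5" | "n \<ge> 6" using assms by linarith
  then have "bob_wins n True Map.empty"
  proof cases
    case 1
    have "bob_wins 4 False [1 \<mapsto> 1]"
      by (rule bob_wins_if_refutes[OF _ refutes_4, of 0]) auto
    moreover have "legal 4 Map.empty 1 1" by (intro legal_first_move) auto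
    ultimately show ?thesis using 1 by (blast intro: bob_wins.bob)
  next
    case 2
    have "legal 5 Map.empty 2 3" by (intro legal_first_move) auto
    moreover have "doomed 5 [2 \<mapsto> 3]" by (rule doomed_if_dead[OF _ dead_middle_5]) simp
    ultimately show ?thesis using 2 by (blast intro: bob_wins_by_move)
  qed (rule bob_wins_bob_first)
  with True show ?thesis by simp
qed (use bob_wins_alice_first[OF assms] in simp)

section \<open>The triangle\<close>

text \<open>These invariants of legal play make a complete labeling graceful; the cardinality ties
  the number of moves to the number of labeled vertices.\<close>

lemma legal_play_position:
  assumes "n \<ge> 2" "legal_play (path_square n) h"
  shows "okay n (map_of h) \<and> dom (map_of h) \<subseteq> {..<n} \<and> ran (map_of h) \<subseteq> {..2 * n - 3} \<and>
    inj_on (map_of h) (dom (map_of h)) \<and> card (dom (map_of h)) = length h"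
  using assms(2)
proof (induction h rule: rev_induct)
  case Nil
  show ?case by (simp add: okay_def)
next
  case (snoc m h)
  obtain v l where m: "m = (v, l)" by (cases m)
  define f where "f = map_of h"
  have IH: "okay n f" "dom f \<subseteq> {..<n}" "ran f \<subseteq> {..2 * n - 3}" "inj_on f (dom f)" "card (dom f) = length h"
    and leg: "legal n f v l"
    using snoc m by (simp_all add: legal_play_snoc legal_move_iff[OF assms(1)] f_def)
  have eq: "map_of (h @ [m]) = f(v \<mapsto> l)"
    using leg unfolding m f_def by (intro map_of_snoc) (simp add: legal_def)
  have v: "f v = None" "v < n" "l \<le> 2 * n - 3" "l \<notin> ran f" "okay n (f(v \<mapsto> l))"
    using leg by (auto simp: legal_def)
  have "inj_on (f(v \<mapsto> l)) (insert v (dom f))"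
    using IH(4) v(1,4) by (auto simp: inj_on_def ran_def)
  moreover have "finite (dom f)" unfolding f_def by (rule finite_dom_map_of)
  ultimately have "okay n g \<and> dom g \<subseteq> {..<n} \<and> ran g \<subseteq> {..2 * n - 3} \<and> inj_on g (dom g) \<and>
      card (dom g) = length (h @ [m])" if "g = f(v \<mapsto> l)" for g
    unfolding that using IH v by (simp add: domIff)
  from this[OF eq] show ?case .
qed

text \<open>Labels \<open>0\<close>, \<open>3\<close> and \<open>x\<close> with \<open>x\<close> in
  \<open>{1, 2}\<close> have the distinct differences 3, \<open>x\<close> and \<open>3 - x\<close>.
  Once \<open>0\<close> or \<open>3\<close> is present, such a set can always be completed.\<close>

lemma legal_third_move_triangle:
  assumes "u < 3" "v < 3" "t < 3" "u \<noteq> v" "t \<noteq> u" "t \<noteq> v" "a \<noteq> b" "a \<le> 3" "b \<le> 3"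
    and "{a, b} \<inter> {0, 3} \<noteq> {}"
  shows "\<exists>l. legal 3 [u \<mapsto> a, v \<mapsto> b] t l"
proof -
  define l :: nat where "l = (if {a, b} = {0, 3} then 1 else if 0 \<in> {a, b} then 3 else 0)"
  have "a \<in> {0, 1, 2, 3}" "b \<in> {0, 1, 2, 3}" using assms by auto
  with assms have l: "l \<noteq> a" "l \<noteq> b" "l \<le> 3"
    and lab: "\<bar>int l - int a\<bar> \<noteq> \<bar>int l - int b\<bar>" "\<bar>int l - int a\<bar> \<noteq> \<bar>int a - int b\<bar>"
      "\<bar>int l - int b\<bar> \<noteq> \<bar>int a - int b\<bar>"
    by (auto simp: l_def doubleton_eq_iff)
  have ok: "okay 3 [u \<mapsto> a, v \<mapsto> b]"
    using legal_second_move[of v 3 u b a] assms by (simp add: legal_def)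
  have dom: "p = u \<and> i = a \<or> p = v \<and> i = b" if "[u \<mapsto> a, v \<mapsto> b] p = Some i" for p i
    using that by (auto split: if_splits)
  have "okay 3 ([u \<mapsto> a, v \<mapsto> b](t \<mapsto> l))"
  proof (rule okay_upd[OF ok])
    fix p x y i c d
    assume f: "[u \<mapsto> a, v \<mapsto> b] p = Some i" "[u \<mapsto> a, v \<mapsto> b] x = Some c" "[u \<mapsto> a, v \<mapsto> b] y = Some d"
      and "adj 3 x y"
    then have "\<bar>int c - int d\<bar> = \<bar>int a - int b\<bar>"
      using dom[OF f(2)] dom[OF f(3)] by (auto simp: abs_minus_commute)
    with lab dom[OF f(1)] show "\<bar>int l - int i\<bar> \<noteq> \<bar>int c - int d\<bar>" by auto
  next
    fix p p' i i'
    assume f: "[u \<mapsto> a, v \<mapsto> b] p = Some i" "[u \<mapsto> a, v \<mapsto> b] p' = Some i'" and "p \<noteq> p'"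
    then show "\<bar>int l - int i\<bar> \<noteq> \<bar>int l - int i'\<bar>"
      using lab(1) dom[OF f(1)] dom[OF f(2)] by auto
  qed (use assms in auto)
  with l assms have "legal 3 [u \<mapsto> a, v \<mapsto> b] t l"
    by (auto simp: legal_def ran_def split: if_splits)
  then show ?thesis by blast
qed

text \<open>Alice only has to ensure that \<open>0\<close> or \<open>3\<close> is among the first
  two labels: she plays \<open>0\<close> when she starts, or after Bob opens with \<open>1\<close>
  or \<open>2\<close>. From then on any legal move preserves the invariant.\<close>

lemma alice_has_winning_strategy_triangle:
  "has_winning_strategy (path_square 3) first Alice"
proof (rule has_winning_strategyI[where
    W = "\<lambda>h. h = [] \<or> length h = 1 \<and> to_move first h = Alice \<or> snd ` set h \<inter> {0, 3} \<noteq> {}"])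
  let ?G = "path_square 3"
  let ?W = "\<lambda>h. h = [] \<or> length h = 1 \<and> to_move first h = Alice \<or> snd ` set h \<inter> {0, 3} \<noteq> {}"
  have legal_iff: "legal_move ?G h (v, l) \<longleftrightarrow> legal 3 (map_of h) v l" for h v l
    by (simp add: legal_move_iff)
  show "?W []" by simp
  {
    fix h assume play: "legal_play ?G h" and W: "?W h" and fin: "finished ?G h"
    note pos = legal_play_position[OF _ play, simplified]
    have stop: "\<not> legal 3 (map_of h) v l" for v l
      using fin unfolding finished_def legal_iff[symmetric] by blast
    \<comment> \<open>Under the invariant a play of fewer than three moves still admits a legal
      move, so a finished play labels every vertex.\<close>
    have full: "dom (map_of h) = {..<3}"
    proof (rule ccontr)
      assume "dom (map_of h) \<noteq> {..<3}"
      then obtain t where t: "t < 3" "map_of h t = None" and psub: "dom (map_of h) \<subset> {..<3}"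
        using pos by (auto simp: domIff)
      have "length h < 3" using psubset_card_mono[OF _ psub] pos by simp
      then consider "h = []" | u a where "h = [(u, a)]" | u a v b where "h = [(v, b), (u, a)]"
        by (cases h; cases "tl h"; cases "tl (tl h)") auto
      then show False
      proof cases
        case 1
        then show False using stop[of 0 0] legal_first_move[of 0 3 0] by simp
      next
        case (2 u a)
        then show False
          using stop[of t "if a = 0 then 1 else 0"] t
            legal_second_move[of t 3 u "if a = 0 then 1 else 0" a] by (auto split: if_splits)
      next
        case (3 u a v b)
        have "u \<noteq> v" using pos 3 by auto
        moreover from this have "a \<noteq> b" using pos 3 by (auto simp: inj_on_def)
        moreover have "a \<le> 3" "b \<le> 3" "u < 3" "v < 3"
          using pos 3 \<open>u \<noteq> v\<close> by (auto simp: ran_def subset_iff split: if_splits)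
        moreover have "{a, b} \<inter> {0, 3} \<noteq> {}" using W 3 by auto
        ultimately have "\<exists>l. legal 3 [u \<mapsto> a, v \<mapsto> b] t l"
          using t 3 by (intro legal_third_move_triangle) (auto split: if_splits)
        with stop 3 show False by auto
      qed
    qed
    have "inj_on (the \<circ> map_of h) {..<3}"
      using pos full by (auto simp: inj_on_def domIff) (metis option.expand domIff full lessThan_iff)
    moreover have "the (map_of h v) \<le> 3" if "v < 3" for v
      using that pos full by (metis atMost_iff domD lessThan_iff option.sel ranI subsetD)
    moreover have "distinct_edge_labels ?G {..<3} (the \<circ> map_of h)"
      using pos distinct_edge_labels_iff_okay[of 3 "map_of h"] full by simp
    ultimately have "graceful_labeling ?G (the \<circ> map_of h)"
      by (auto simp: graceful_labeling_def card_edges_path_square)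
    with full show "winner ?G h = Alice" by (simp add: winner_def)
  next
    fix h assume play: "legal_play ?G h" and W: "?W h" and nf: "\<not> finished ?G h"
      and Alice: "to_move first h = Alice"
    consider "h = []" | u a where "h = [(u, a)]" "a \<notin> {0, 3}" | "snd ` set h \<inter> {0, 3} \<noteq> {}"
      using W by (cases h; cases "snd ` set h \<inter> {0, 3} = {}") auto
    then show "\<exists>m. legal_move ?G h m \<and> ?W (h @ [m])"
    proof cases
      case 1
      then show ?thesis
        by (intro exI[of _ "(0, 0)"]) (auto simp: legal_iff intro: legal_first_move)
    next
      case 2
      define t :: nat where "t = (if u = 0 then 1 else 0)"
      have "legal 3 [u \<mapsto> a] t 0"
        using 2 by (intro legal_second_move) (auto simp: t_def)
      with 2 show ?thesis by (intro exI[of _ "(t, 0)"]) (auto simp: legal_iff)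
    next
      case 3
      then show ?thesis using nf unfolding finished_def by auto
    qed
  next
    fix h m assume "legal_play ?G h" "?W h" "legal_move ?G h m" "to_move first h \<noteq> Alice"
    moreover have "to_move first [m] = Alice" if "to_move first [] \<noteq> Alice"
      using that by (cases first) (auto simp: to_move_def)
    ultimately show "?W (h @ [m])" by auto
  }
qed

theorem theorem13:
  "(\<forall>n\<ge>4. \<forall>first. has_winning_strategy (graph_square (path_graph n)) first Bob) \<and>
   (\<forall>first. has_winning_strategy (graph_square (path_graph 3)) first Alice)"
  by (auto intro: bob_has_winning_strategy bob_wins_path_square alice_has_winning_strategy_triangle)

end
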